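(* Let $(\mathcal{X},\|\cdot\|)$ be a finite-dimensional real normed vector space and let $A:\mathcal{X}\rightrightarrows\mathcal{X}$ be an accretive set-valued mapping. If $\operatorname{rge}(A)=\mathcal{X}$, then for all scalars $\alpha\geq0$ the set $$\mathcal{D}_\alpha:=\{x\in\mathcal{X}\mid\operatorname{dist}(0,A(x))\leq\alpha\}$$ is bounded. Moreover, if $A$ is $m$-accretive, then the two properties are equivalent, i.e., $\operatorname{rge}(A)=\mathcal{X}$ if and only if $\mathcal{D}_\alpha$ is bounded for all $\alpha\geq0$.
   Context: A set-valued mapping $A:\mathcal{X}\rightrightarrows\mathcal{X}$ sends each point of $\mathcal{X}$ to a (possibly empty) subset of $\mathcal{X}$; $\operatorname{rge}(A)=\bigcup_{x\in\mathcal{X}}A(x)$. For $\mathcal{U}\subset\mathcal{X}$, $\operatorname{dist}(0,\mathcal{U})=\inf_{x\in\mathcal{U}}\|x\|$ (equal to $+\infty$ if $\mathcal{U}=\emptyset$). The dual space $\mathcal{X}^*$ has dual norm $\|\cdot\|_*$ and duality product $\langle\cdot,\cdot\rangle$. The normalized duality mapping $J:\mathcal{X}\rightrightarrows\mathcal{X}^*$ is $J(x)=\{x^*\in\mathcal{X}^*\mid\|x^*\|_*=\|x\|,\ \langle x,x^*\rangle=\|x\|^2\}$. The mapping $A$ is accretive if for all $x,y\in\mathcal{X}$, $u\in A(x)$, $v\in A(y)$, there exists $x^*\in J(x-y)$ with $\langle u-v,x^*\rangle\geq0$. It is $m$-accretive if in addition $\operatorname{rge}(\mathrm{Id}+A)=\mathcal{X}$,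 where $(\mathrm{Id}+A)(x)=\{x+u\mid u\in A(x)\}$. *)

theory Defs
  imports "HOL-Analysis.Analysis"
begin

definition rge :: "('a \<Rightarrow> 'b set) \<Rightarrow> 'b set" where
  "rge A = (\<Union>x. A x)"

text \<open>Extended-real valued, so that the distance to the empty set is \<open>\<infinity>\<close>
  (the library's \<^const>\<open>infdist\<close> gives \<open>0\<close> there).\<close>

definition dist_zero :: "'a::real_normed_vector set \<Rightarrow> ereal" where
  "dist_zero U = (INF x\<in>U. ereal (norm x))"

text \<open>The dual space is the type \<^typ>\<open>'a \<Rightarrow>\<^sub>L real\<close>, whose norm is the operator norm,
  i.e. the dual norm; the duality product of \<open>x\<close> and \<open>x'\<close> is \<^term>\<open>blinfun_apply x' x\<close>.\<close>

definition duality_map :: "'a::real_normed_vector \<Rightarrow> ('a \<Rightarrow>\<^sub>L real) set" where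
  "duality_map x = {x'. norm x' = norm x \<and> blinfun_apply x' x = (norm x)\<^sup>2}"

definition accretive :: "('a::real_normed_vector \<Rightarrow> 'a set) \<Rightarrow> bool" where
  "accretive A \<longleftrightarrow>
    (\<forall>x y. \<forall>u\<in>A x. \<forall>v\<in>A y. \<exists>x'\<in>duality_map (x - y). blinfun_apply x' (u - v) \<ge> 0)"

definition m_accretive :: "('a::real_normed_vector \<Rightarrow> 'a set) \<Rightarrow> bool" where
  "m_accretive A \<longleftrightarrow> accretive A \<and> rge (\<lambda>x. {x + u | u. u \<in> A x}) = UNIV"

definition dist_sublevel :: "('a::real_normed_vector \<Rightarrow> 'a set) \<Rightarrow> real \<Rightarrow> 'a set" where
  "dist_sublevel A \<alpha> = {x. dist_zero (A x) \<le> ereal \<alpha>}"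

end

theory Submission
  imports Defs
begin

text \<open>If \<open>rge A = UNIV\<close> but some \<open>D\<^sub>\<alpha>\<close> is unbounded, there are \<open>u\<^sub>n \<in> A x\<^sub>n\<close> with
  \<open>u\<^sub>n \<rightarrow> u\<close>, \<open>\<parallel>x\<^sub>n\<parallel> \<rightarrow> \<infinity>\<close> and \<open>x\<^sub>n / \<parallel>x\<^sub>n\<parallel> \<rightarrow> e\<close>. Choosing \<open>y\<close> with \<open>u + e \<in> A y\<close>,
  accretivity provides functionals \<open>f\<^sub>n\<close> of norm one that attain the norm of \<open>x\<^sub>n - y\<close>, so
  \<open>f\<^sub>n e \<rightarrow> 1\<close>, while \<open>f\<^sub>n (u\<^sub>n - u - e) \<ge> 0\<close> forces \<open>limsup f\<^sub>n e \<le> 0\<close>.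

  Conversely, let \<open>A\<close> be m-accretive and let \<open>v\<close> be given. For \<open>0 < \<lambda> \<le> 1\<close> the contraction
  principle, applied to \<open>x \<mapsto> (Id + A)\<^sup>-\<^sup>1 (v + (1 - \<lambda>) x)\<close>, yields \<open>x\<^sub>\<lambda>\<close> with
  \<open>v - \<lambda> x\<^sub>\<lambda> \<in> A x\<^sub>\<lambda>\<close>. Accretivity bounds \<open>\<lambda> x\<^sub>\<lambda>\<close>, hence \<open>x\<^sub>\<lambda>\<close> stays in some \<open>D\<^sub>\<alpha>\<close> and has a
  limit point as \<open>\<lambda> \<rightarrow> 0\<close>; it solves \<open>v \<in> A x\<close> because the graph of \<open>A\<close> is closed.\<close>

section \<open>Compactness and completeness in finite dimension\<close>

text \<open>Bolzano-Weierstrass by induction on the spanning set. A new vector \<open>b\<close>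
  outside \<open>span B\<close> has positive distance to it, so the \<open>b\<close>-coefficients of
  a bounded sequence are bounded.\<close>

lemma bounded_seq_in_finite_span_convergent_subseq:
  fixes B :: "'a::real_normed_vector set"
  assumes "finite B" and "range x \<subseteq> span B" and "bounded (range x)"
  shows "\<exists>l\<in>span B. \<exists>r::nat \<Rightarrow> nat. strict_mono r \<and> (x \<circ> r) \<longlonglongrightarrow> l"
  using assms
proof (induction B arbitrary: x rule: finite_induct)
  case empty
  then have "x = (\<lambda>_. 0)"
    by auto
  then have "(x \<circ> id) \<longlonglongrightarrow> 0"
    by simp
  then show ?case
    using strict_mono_id by auto
next
  case (insert b B)
  show ?case
  proof (cases "b \<in> span B")
    case True
    then show ?thesis
      using insert by (simp add: span_redundant)
  next
    case False
    \<comment> \<open>A convergent sequence is bounded, so the induction hypothesis puts a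
      subsequential limit, hence the limit, in \<open>span B\<close>.\<close>
    have closed: "closed (span B)"
      unfolding closed_sequential_limits
    proof (intro allI impI, elim conjE)
      fix y l assume y: "\<forall>n. y n \<in> span B" and lim: "y \<longlonglongrightarrow> l"
      have "bounded (range y)"
        using lim by (rule convergent_imp_bounded)
      with insert.IH[of y] y obtain l' r where l': "l' \<in> span B" "strict_mono (r::nat \<Rightarrow> nat)" "(y \<circ> r) \<longlonglongrightarrow> l'"
        by blast
      with LIMSEQ_subseq_LIMSEQ[OF lim l'(2)] show "l \<in> span B"
        using LIMSEQ_unique by blast
    qed
    define d where "d = infdist b (span B)"
    have "span B \<noteq> {}"
      using span_zero by blast
    then have "d \<noteq> 0"
      using in_closed_iff_infdist_zero[OF closed] False by (simp add: d_def)
    then have d: "d > 0"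
      using infdist_nonneg[of b "span B"] by (simp add: d_def)
    \<comment> \<open>Homogeneity: factor out \<open>t\<close> and compare \<open>b\<close> with a
      point of \<open>span B\<close>.\<close>
    have dist: "\<bar>t\<bar> * d \<le> norm (t *\<^sub>R b + y)" if "y \<in> span B" for t y
    proof (cases "t = 0")
      case t: False
      have "- (1 / t) *\<^sub>R y \<in> span B"
        using that by (intro span_scale)
      then have "d \<le> dist b (- (1 / t) *\<^sub>R y)"
        unfolding d_def by (rule infdist_le)
      then have "d \<le> norm (b + (1 / t) *\<^sub>R y)"
        by (simp add: dist_norm)
      then have "\<bar>t\<bar> * d \<le> norm (t *\<^sub>R (b + (1 / t) *\<^sub>R y))"
        by (simp add: mult_left_mono)
      also have "t *\<^sub>R (b + (1 / t) *\<^sub>R y) = t *\<^sub>R b + y"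
        using t by (simp add: scaleR_add_right)
      finally show ?thesis .
    qed auto
    have "\<forall>n. \<exists>t. x n - t *\<^sub>R b \<in> span B"
      using insert.prems(1) span_breakdown_eq by blast
    then obtain t where t: "\<And>n. x n - t n *\<^sub>R b \<in> span B"
      by metis
    obtain M where M: "\<And>n. norm (x n) \<le> M"
      using insert.prems(2) by (auto simp: bounded_iff)
    have tM: "norm (t n) \<le> M / d" for n
      using dist[OF t[of n], of "t n"] M[of n] d by (simp add: field_simps)
    then have "bounded (range t)"
      by (auto simp: bounded_iff)
    then obtain s r where r: "strict_mono (r::nat \<Rightarrow> nat)" "(t \<circ> r) \<longlonglongrightarrow> s"
      using bounded_imp_convergent_subsequence by blast
    \<comment> \<open>The remainders are bounded in \<open>span B\<close>, so a second extraction
      makes them converge along with the coefficients.\<close>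
    define y where "y = (\<lambda>n. x (r n) - t (r n) *\<^sub>R b)"
    have "norm (y n) \<le> M + M / d * norm b" for n
    proof -
      have "norm (y n) \<le> norm (x (r n)) + norm (t (r n) *\<^sub>R b)"
        unfolding y_def by (rule norm_triangle_ineq4)
      also have "\<dots> \<le> M + M / d * norm b"
        using M[of "r n"] mult_right_mono[OF tM[of "r n"], of "norm b"] by simp
      finally show ?thesis .
    qed
    then have "bounded (range y)"
      by (auto simp: bounded_iff)
    moreover have "range y \<subseteq> span B"
      using t by (auto simp: y_def)
    ultimately obtain l q where l: "l \<in> span B" "strict_mono (q::nat \<Rightarrow> nat)" "(y \<circ> q) \<longlonglongrightarrow> l"
      using insert.IH by blast
    have "(\<lambda>n. (t \<circ> r \<circ> q) n *\<^sub>R b + (y \<circ> q) n) \<longlonglongrightarrow> s *\<^sub>R b + l"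
      using LIMSEQ_subseq_LIMSEQ[OF r(2) l(2)] l(3) by (intro tendsto_intros)
    then have "(x \<circ> (r \<circ> q)) \<longlonglongrightarrow> s *\<^sub>R b + l"
      by (simp add: y_def o_def)
    moreover have "s *\<^sub>R b + l \<in> span (insert b B)"
      using l(1) by (metis span_add span_base span_scale insertI1 span_mono subset_insertI subsetD)
    ultimately show ?thesis
      using strict_mono_o[OF r(1) l(2)] by blast
  qed
qed

lemma finite_span_complete_UNIV:
  fixes B :: "'a::real_normed_vector set"
  assumes "finite B" and "span B = UNIV"
  shows "complete (UNIV :: 'a set)"
  unfolding complete_def
proof (intro allI impI, elim conjE)
  fix f :: "nat \<Rightarrow> 'a" assume "Cauchy f"
  then have "bounded (range f)"
    by (rule cauchy_imp_bounded)
  then obtain l r where "strict_mono (r::nat \<Rightarrow> nat)" "(f \<circ> r) \<longlonglongrightarrow> l"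
    using bounded_seq_in_finite_span_convergent_subseq[of B f] assms by blast
  with \<open>Cauchy f\<close> show "\<exists>l\<in>UNIV. f \<longlonglongrightarrow> l"
    using Cauchy_converges_subseq by blast
qed

section \<open>Norm inequalities from accretivity\<close>

lemma accretive_unit_functional:
  assumes "accretive A" and "u \<in> A x" and "v \<in> A y" and "x \<noteq> y"
  obtains f where "norm f = 1" and "blinfun_apply f (x - y) = norm (x - y)"
    and "blinfun_apply f (u - v) \<ge> 0"
proof -
  obtain g where g: "norm g = norm (x - y)" "blinfun_apply g (x - y) = (norm (x - y))\<^sup>2"
    "blinfun_apply g (u - v) \<ge> 0"
    using assms unfolding accretive_def duality_map_def by blast
  define f where "f = (1 / norm (x - y)) *\<^sub>R g"
  show thesis
  proof
    show "norm f = 1" "blinfun_apply f (x - y) = norm (x - y)" "blinfun_apply f (u - v) \<ge> 0"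
      using g assms(4) by (auto simp: f_def scaleR_blinfun.rep_eq power2_eq_square)
  qed
qed

text \<open>Evaluate the norming functional of \<open>x - y\<close> at the vector on the right. The
  case \<open>l = 1\<close> makes the resolvent nonexpansive; small \<open>l\<close> bounds the
  regularized solutions.\<close>

lemma accretive_norm_le:
  assumes "accretive A" and "u \<in> A x" and "v \<in> A y" and "l \<ge> 0"
  shows "l * norm (x - y) \<le> norm (l *\<^sub>R (x - y) + (u - v))"
proof (cases "x = y")
  case False
  then obtain f where f: "norm f = 1" "blinfun_apply f (x - y) = norm (x - y)"
    "blinfun_apply f (u - v) \<ge> 0"
    using accretive_unit_functional assms by metis
  have "l * norm (x - y) \<le> blinfun_apply f (l *\<^sub>R (x - y) + (u - v))"
    using f(2,3) by (simp add: blinfun.add_right blinfun.scaleR_right)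
  also have "\<dots> \<le> norm f * norm (l *\<^sub>R (x - y) + (u - v))"
    using norm_blinfun[of f "l *\<^sub>R (x - y) + (u - v)"] by simp
  finally show ?thesis
    using f(1) by simp
qed simp

section \<open>Closed graph and resolvent of an m-accretive mapping\<close>

lemma m_accretiveE:
  assumes "m_accretive A"
  obtains x u where "u \<in> A x" and "x + u = w"
proof -
  have "w \<in> rge (\<lambda>x. {x + u | u. u \<in> A x})"
    using assms by (simp add: m_accretive_def)
  then show thesis
    using that by (auto simp: rge_def)
qed

text \<open>Solve the inclusion \<open>p + w \<in> z + A z\<close>. The accretive inequality between
  \<open>x n\<close> and \<open>z\<close> passes to the limit, where its right side is 0, so
  \<open>z = p\<close>.\<close>

lemma m_accretive_closed_graph:
  assumes "m_accretive A" and "\<And>n. u n \<in> A (x n)" and "x \<longlonglongrightarrow> p" and "u \<longlonglongrightarrow> w"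
  shows "w \<in> A p"
proof -
  obtain z h where z: "h \<in> A z" "z + h = p + w"
    using m_accretiveE[OF assms(1)] by blast
  have "norm (x n - z) \<le> norm ((x n - z) + (u n - h))" for n
    using accretive_norm_le[of A "u n" "x n" h z 1] assms(1,2) z(1) by (simp add: m_accretive_def)
  moreover have "(\<lambda>n. norm (x n - z)) \<longlonglongrightarrow> norm (p - z)"
    using assms(3) by (intro tendsto_intros)
  moreover have "(\<lambda>n. norm ((x n - z) + (u n - h))) \<longlonglongrightarrow> norm ((p - z) + (w - h))"
    using assms(3,4) by (intro tendsto_intros)
  ultimately have "norm (p - z) \<le> norm ((p - z) + (w - h))"
    by (meson LIMSEQ_le)
  also have "(p - z) + (w - h) = 0"
    using z(2) by (simp add: algebra_simps)
  finally have "z = p"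
    by simp
  with z show ?thesis
    by simp
qed

lemma m_accretive_resolvent:
  fixes A :: "'a::real_normed_vector \<Rightarrow> 'a set"
  assumes "complete (UNIV :: 'a set)" and "m_accretive A" and "0 < l" and "l \<le> 1"
  obtains x where "v - l *\<^sub>R x \<in> A x"
proof -
  \<comment> \<open>\<open>R\<close> selects a value of the resolvent
    \<open>(Id + A)\<^sup>-\<^sup>1\<close>.\<close>
  have "\<forall>w. \<exists>x. w - x \<in> A x"
    using m_accretiveE[OF assms(2)] by (metis add_diff_cancel_left')
  then obtain R where R: "\<And>w. w - R w \<in> A (R w)"
    by metis
  have nonexp: "norm (R w - R w') \<le> norm (w - w')" for w w'
  proof -
    have "norm (R w - R w') \<le> norm ((R w - R w') + ((w - R w) - (w' - R w')))"
      using accretive_norm_le[of A "w - R w" "R w" "w' - R w'" "R w'" 1] assms(2) R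
      by (simp add: m_accretive_def)
    also have "(R w - R w') + ((w - R w) - (w' - R w')) = w - w'"
      by simp
    finally show ?thesis .
  qed
  have "dist (R (v + (1 - l) *\<^sub>R x)) (R (v + (1 - l) *\<^sub>R y)) \<le> (1 - l) * dist x y" for x y
    using nonexp[of "v + (1 - l) *\<^sub>R x" "v + (1 - l) *\<^sub>R y"] assms(4)
    by (simp add: dist_norm flip: scaleR_diff_right)
  then have "\<exists>!x\<in>UNIV. R (v + (1 - l) *\<^sub>R x) = x"
    using assms by (intro Banach_fix[where c = "1 - l"]) auto
  then obtain x where x: "R (v + (1 - l) *\<^sub>R x) = x"
    by auto
  have "v - l *\<^sub>R x = v + (1 - l) *\<^sub>R x - x"
    by (simp add: algebra_simps)
  also have "\<dots> \<in> A x"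
    using R[of "v + (1 - l) *\<^sub>R x"] by (simp add: x)
  finally show thesis
    by (rule that)
qed

lemma mem_dist_sublevelI:
  assumes "u \<in> A x" and "norm u \<le> \<alpha>"
  shows "x \<in> dist_sublevel A \<alpha>"
proof -
  have "dist_zero (A x) \<le> ereal (norm u)"
    unfolding dist_zero_def using assms(1) by (rule INF_lower)
  also have "\<dots> \<le> ereal \<alpha>"
    using assms(2) by simp
  finally show ?thesis
    by (simp add: dist_sublevel_def)
qed

text \<open>The infimum need not be attained, hence the slack between \<alpha> and \<beta>.\<close>

lemma mem_dist_sublevelE:
  assumes "x \<in> dist_sublevel A \<alpha>" and "\<alpha> < \<beta>"
  obtains u where "u \<in> A x" and "norm u < \<beta>"
proof -
  have "(INF u\<in>A x. ereal (norm u)) < ereal \<beta>"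
    using assms by (auto simp: dist_sublevel_def dist_zero_def intro: le_less_trans)
  then show thesis
    using that by (auto simp: INF_less_iff)
qed

section \<open>Surjectivity implies bounded sublevel sets\<close>

lemma accretive_surj_bounded_dist_sublevel:
  fixes A :: "'a::real_normed_vector \<Rightarrow> 'a set"
  assumes "finite B" and "span B = (UNIV :: 'a set)" and "accretive A" and "rge A = UNIV"
  shows "bounded (dist_sublevel A \<alpha>)"
proof (rule ccontr)
  assume unbounded: "\<not> bounded (dist_sublevel A \<alpha>)"
  have "\<exists>x u. norm x > real n \<and> u \<in> A x \<and> norm u \<le> \<alpha> + 1" for n
  proof -
    obtain x where x: "x \<in> dist_sublevel A \<alpha>" "norm x > real n"
      using unbounded by (auto simp: bounded_iff not_le)
    then obtain u where "u \<in> A x" "norm u < \<alpha> + 1"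
      using mem_dist_sublevelE[of x A \<alpha> "\<alpha> + 1"] by auto
    with x show ?thesis
      by (intro exI[of _ x] exI[of _ u]) auto
  qed
  then obtain x u where x: "\<And>n. norm (x n) > real n" and u: "\<And>n. u n \<in> A (x n)"
    and u_le: "\<And>n. norm (u n) \<le> \<alpha> + 1"
    by metis
  have "bounded (range u)"
    using u_le by (auto simp: bounded_iff)
  then obtain w r where r: "strict_mono (r::nat \<Rightarrow> nat)" "(u \<circ> r) \<longlonglongrightarrow> w"
    using bounded_seq_in_finite_span_convergent_subseq[of B u] assms(1,2) by blast
  define e where "e n = x n /\<^sub>R norm (x n)" for n
  have e_le: "norm (e n) \<le> 1" for n
    by (cases "x n = 0") (simp_all add: e_def)
  have "bounded (range (e \<circ> r))"
    using e_le by (auto simp: bounded_iff)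
  then obtain p q where q: "strict_mono (q::nat \<Rightarrow> nat)" "(e \<circ> r \<circ> q) \<longlonglongrightarrow> p"
    using bounded_seq_in_finite_span_convergent_subseq[of B "e \<circ> r"] assms(1,2) by blast
  obtain y where y: "w + p \<in> A y"
    using assms(4) by (metis UN_E UNIV_I rge_def)
  define s where "s = r \<circ> q"
  have s: "strict_mono s"
    unfolding s_def using r(1) q(1) by (rule strict_mono_o)
  have u_lim: "(\<lambda>n. u (s n)) \<longlonglongrightarrow> w"
    using LIMSEQ_subseq_LIMSEQ[OF r(2) q(1)] by (simp add: s_def o_def)
  have e_lim: "(\<lambda>n. e (s n)) \<longlonglongrightarrow> p"
    using q(2) by (simp add: s_def o_def)
  \<comment> \<open>Quantitative form of the contradiction: every term on the right vanishes along
    \<open>s\<close>.\<close>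
  have bound: "1 \<le> norm (u m - w) + 2 * norm y / real m + norm (p - e m)"
    if m: "real m > norm y" for m
  proof -
    have pos: "norm (x m) > 0" "real m > 0"
      using x[of m] m norm_ge_zero[of y] by linarith+
    have "x m \<noteq> y"
      using x[of m] m by auto
    then obtain f where f: "norm f = 1" "blinfun_apply f (x m - y) = norm (x m - y)"
      "blinfun_apply f (u m - (w + p)) \<ge> 0"
      using accretive_unit_functional[OF assms(3) u y] by metis
    have f_le: "blinfun_apply f z \<le> norm z" for z
      using norm_blinfun[of f z] f(1) by simp
    \<comment> \<open>\<open>f\<close> norms \<open>x m - y\<close>, so replacing that vector by
      \<open>x m\<close> costs at most \<open>norm y\<close>, and the triangle inequality costs
      another.\<close>
    have "norm (x m) - 2 * norm y \<le> norm (x m - y) - norm (- y)"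
      using norm_triangle_ineq2[of "x m" y] by simp
    also have "\<dots> \<le> blinfun_apply f (x m)"
      using f(2) f_le[of "- y"] by (simp add: blinfun.diff_right blinfun.minus_right)
    also have "\<dots> = norm (x m) * blinfun_apply f (e m)"
      using pos by (simp add: e_def blinfun.scaleR_right)
    finally have "norm (x m) - 2 * norm y \<le> norm (x m) * blinfun_apply f (e m)" .
    then have "1 - 2 * norm y / norm (x m) \<le> blinfun_apply f (e m)"
      using pos by (simp add: field_simps)
    moreover have "2 * norm y / norm (x m) \<le> 2 * norm y / real m"
      using x[of m] pos by (intro divide_left_mono) auto
    \<comment> \<open>The choice of \<open>y\<close> enters here: accretivity gives
      \<open>f p \<le> f (u m - w)\<close>.\<close>
    moreover have "blinfun_apply f p \<le> norm (u m - w)"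
      using f(3) f_le[of "u m - w"] by (simp add: blinfun.diff_right blinfun.add_right)
    moreover have "blinfun_apply f (e m) - blinfun_apply f p \<le> norm (p - e m)"
      using f_le[of "e m - p"] by (simp add: blinfun.diff_right norm_minus_commute)
    ultimately show ?thesis
      by linarith
  qed
  have s_lim: "filterlim (\<lambda>n. real (s n)) at_top sequentially"
    using filterlim_compose[OF filterlim_real_sequentially filterlim_subseq[OF s]] .
  have "(\<lambda>n. norm (u (s n) - w) + 2 * norm y / real (s n) + norm (p - e (s n)))
      \<longlonglongrightarrow> norm (w - w) + 0 + norm (p - p)"
    using u_lim e_lim s_lim
    by (intro tendsto_intros tendsto_divide_0[OF tendsto_const] filterlim_at_top_imp_at_infinity)
  moreover have "\<forall>\<^sub>F n in sequentially.
      1 \<le> norm (u (s n) - w) + 2 * norm y / real (s n) + norm (p - e (s n))"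
    using s_lim[unfolded filterlim_at_top_dense, rule_format, of "norm y"]
    by eventually_elim (rule bound)
  ultimately have "(1::real) \<le> norm (w - w) + 0 + norm (p - p)"
    by (intro tendsto_lowerbound) auto
  then show False
    by simp
qed

section \<open>Bounded sublevel sets imply surjectivity\<close>

lemma m_accretive_bounded_dist_sublevel_surj:
  fixes A :: "'a::real_normed_vector \<Rightarrow> 'a set"
  assumes "finite B" and "span B = (UNIV :: 'a set)" and "m_accretive A"
    and bdd: "\<And>\<alpha>. \<alpha> \<ge> 0 \<Longrightarrow> bounded (dist_sublevel A \<alpha>)"
  shows "rge A = UNIV"
proof -
  have "v \<in> rge A" for v
  proof -
    define l where "l n = inverse (real (Suc n))" for n
    have l: "0 < l n" "l n \<le> 1" for n
      by (auto simp: l_def field_simps)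
    have "\<exists>x. v - l n *\<^sub>R x \<in> A x" for n
      using m_accretive_resolvent[OF finite_span_complete_UNIV[OF assms(1,2)] assms(3) l] by metis
    then obtain x where x: "\<And>n. v - l n *\<^sub>R x n \<in> A (x n)"
      by metis
    obtain x0 u0 where x0: "u0 \<in> A x0"
      using m_accretiveE[OF assms(3)] by metis
    \<comment> \<open>Comparison with the fixed graph point \<open>(x0, u0)\<close> bounds
      \<open>l n *\<^sub>R (x n - x0)\<close> by \<open>norm (v - u0) + norm x0\<close>; restoring
      \<open>l n *\<^sub>R x0\<close> and \<open>v\<close> adds the rest.\<close>
    define \<alpha> where "\<alpha> = norm (v - u0) + 2 * norm x0 + norm v"
    have "norm (v - l n *\<^sub>R x n) \<le> \<alpha>" for n
    proof -
      have x0_le: "l n * norm x0 \<le> norm x0"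
        using l[of n] by (simp add: mult_left_le_one_le)
      have "l n * norm (x n - x0) \<le> norm (l n *\<^sub>R (x n - x0) + (v - l n *\<^sub>R x n - u0))"
        using accretive_norm_le[OF _ x x0] l(1)[of n] assms(3) by (simp add: m_accretive_def)
      also have "l n *\<^sub>R (x n - x0) + (v - l n *\<^sub>R x n - u0) = (v - u0) - l n *\<^sub>R x0"
        by (simp add: algebra_simps)
      also have "norm \<dots> \<le> norm (v - u0) + l n * norm x0"
        using norm_triangle_ineq4[of "v - u0" "l n *\<^sub>R x0"] l(1)[of n] by simp
      finally have 1: "norm (l n *\<^sub>R (x n - x0)) \<le> norm (v - u0) + norm x0"
        using x0_le l(1)[of n] by simp
      have "v - l n *\<^sub>R x n = v - (l n *\<^sub>R (x n - x0) + l n *\<^sub>R x0)"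
        by (simp add: algebra_simps)
      also have "norm \<dots> \<le> norm v + (norm (l n *\<^sub>R (x n - x0)) + norm (l n *\<^sub>R x0))"
        by (intro order_trans[OF norm_triangle_ineq4] add_left_mono norm_triangle_ineq)
      also have "\<dots> \<le> \<alpha>"
        using 1 x0_le l(1)[of n] by (simp add: \<alpha>_def)
      finally show ?thesis .
    qed
    then have "range x \<subseteq> dist_sublevel A \<alpha>"
      using x mem_dist_sublevelI by blast
    moreover have "\<alpha> \<ge> 0"
      by (simp add: \<alpha>_def)
    ultimately have "bounded (range x)"
      using bdd bounded_subset by blast
    then obtain p r where r: "strict_mono (r::nat \<Rightarrow> nat)" "(x \<circ> r) \<longlonglongrightarrow> p"
      using bounded_seq_in_finite_span_convergent_subseq[of B x] assms(1,2) by blast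
    have "(l \<circ> r) \<longlonglongrightarrow> 0"
      using LIMSEQ_subseq_LIMSEQ[OF LIMSEQ_inverse_real_of_nat r(1)] by (simp add: l_def o_def)
    \<comment> \<open>Since \<open>x \<circ> r\<close> converges, the regularizing term vanishes and
      the closed graph applies.\<close>
    then have "(\<lambda>n. v - (l \<circ> r) n *\<^sub>R (x \<circ> r) n) \<longlonglongrightarrow> v - 0 *\<^sub>R p"
      using r(2) by (intro tendsto_intros)
    then have "v \<in> A p"
      using m_accretive_closed_graph[OF assms(3) _ r(2), of "\<lambda>n. v - (l \<circ> r) n *\<^sub>R (x \<circ> r) n" v] x
      by simp
    then show ?thesis
      by (auto simp: rge_def)
  qed
  then show ?thesis
    by auto
qed

theorem theorem3p12:
  fixes A :: "'a::real_normed_vector \<Rightarrow> 'a set"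
  assumes "\<exists>B::'a set. finite B \<and> span B = UNIV"
    and "accretive A"
  shows "(rge A = UNIV \<longrightarrow> (\<forall>\<alpha>\<ge>0. bounded (dist_sublevel A \<alpha>))) \<and>
    (m_accretive A \<longrightarrow> (rge A = UNIV \<longleftrightarrow> (\<forall>\<alpha>\<ge>0. bounded (dist_sublevel A \<alpha>))))"
proof -
  obtain B :: "'a set" where "finite B" "span B = UNIV"
    using assms(1) by blast
  then show ?thesis
    using accretive_surj_bounded_dist_sublevel[of B A] m_accretive_bounded_dist_sublevel_surj[of B A]
      assms(2) by blast
qed

end
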